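(* There is an isolation scheme for Hamiltonian cycles in undirected graphs that uses $\mathcal{O}(n)$ random bits and assigns weights upper bounded by $2^{\mathcal{O}(n)}$. That is, there is an absolute constant $C$ such that for all $n,m\in\mathbb{N}$ there exist weight functions $\omega_1,\ldots,\omega_\ell\colon[m]\to\mathbb{N}$ with $\log\ell\le Cn$ and all values at most $2^{Cn}$, such that for every undirected $n$-vertex graph $G$ whose edge set is identified with $[m]$, at least half of the indices $i\in[\ell]$ satisfy: $\omega_i$ isolates the family $\mathsf{HC}(G)$.
   Context: For a finite set $U$, a weight function $\omega\colon U\to\mathbb{N}$ and $X\subseteq U$, write $\omega(X)=\sum_{e\in X}\omega(e)$. A weight function $\omega$ isolates a family $\mathcal{F}\subseteq 2^U$ if there is exactly one $S\in\mathcal{F}$ with $\omega(S)=\min_{S'\in\mathcal{F}}\omega(S')$. $\mathsf{HC}(G)$ is the family of edge sets of Hamiltonian cycles of $G$. An isolation scheme for an edge selection problem on a graph class provides, for every $m$, weight functions $\omega_1,\ldots,\omega_\ell\colon[m]\to\mathbb{N}$ such that for every graph in the class with edges enumerated by $[m]$, at least half of the $\omega_i$ isolate the family; the number of random bits is $\log\ell$ and the maximum weight is the maximum value taken by any $\omega_i$. Here $[k]=\{1,\ldots,k\}$.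
   Formalization: The claim is stated only for graphs that have a Hamiltonian cycle, since by the literal definition no weight function isolates the empty family HC(G); vertices are taken to be natural numbers. *)

theory Defs
  imports Complex_Main
begin

definition simple_graph :: "'v set \<Rightarrow> 'v set set \<Rightarrow> bool" where
  "simple_graph V E \<longleftrightarrow> finite V \<and> (\<forall>e\<in>E. e \<subseteq> V \<and> card e = 2)"

(* The closing edge joins the last vertex of the list to the first one. *)
definition cycle_edges :: "'v list \<Rightarrow> 'v set set" where
  "cycle_edges vs = {{vs ! i, vs ! (Suc i mod length vs)} | i. i < length vs}"

definition hamiltonian_cycle :: "'v set \<Rightarrow> 'v set set \<Rightarrow> 'v list \<Rightarrow> bool" where
  "hamiltonian_cycle V E vs \<longleftrightarrow>
     3 \<le> length vs \<and> distinct vs \<and> set vs = V \<and> cycle_edges vs \<subseteq> E"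

definition HC :: "'v set \<Rightarrow> 'v set set \<Rightarrow> 'v set set set" where
  "HC V E = {cycle_edges vs | vs. hamiltonian_cycle V E vs}"

(* HC(G) as a family of subsets of [m], for the enumeration f of the edges. *)
definition HC_enum :: "'v set \<Rightarrow> 'v set set \<Rightarrow> nat \<Rightarrow> (nat \<Rightarrow> 'v set) \<Rightarrow> nat set set" where
  "HC_enum V E m f = {X. X \<subseteq> {1..m} \<and> f ` X \<in> HC V E}"

definition weight :: "('u \<Rightarrow> nat) \<Rightarrow> 'u set \<Rightarrow> nat" where
  "weight \<omega> X = (\<Sum>e\<in>X. \<omega> e)"

(* Meant for finite families of finite sets. The empty family is isolated by no
   weight function. *)
definition isolates :: "('u \<Rightarrow> nat) \<Rightarrow> 'u set set \<Rightarrow> bool" where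
  "isolates \<omega> F \<longleftrightarrow> (\<exists>!S. S \<in> F \<and> weight \<omega> S = Min (weight \<omega> ` F))"

end

theory Submission
  imports Defs "HOL-Library.FuncSet"
begin

text \<open>
  By the isolation lemma of Mulmuley, Vazirani and Vazirani, uniformly random weights from
  \<open>{1..16 * m}\<close> fail to isolate a fixed nonempty family with probability at most \<open>1/16\<close>. Up to
  renaming the vertices, an \<open>n\<close>-vertex graph with enumerated edges is a map from \<open>[m]\<close> to the
  subsets of \<open>[n]\<close>, so at most \<open>2 ^ (n * m)\<close> families matter. Since nothing is demanded about
  how the scheme is computed, a union bound over these families yields \<open>l = n * m\<close> weight
  functions that work for all of them. The union bound is carried out by conditional
  expectations: weight functions are chosen one after the other so that the sum over all families
  of \<open>16\<close> to the number of failures at most doubles in each step.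
\<close>

section \<open>The isolation lemma\<close>

lemma weight_remove:
  assumes "finite S" "x \<in> S"
  shows "weight \<omega> S = \<omega> x + weight \<omega> (S - {x})"
  using assms by (simp add: weight_def sum.remove)

lemma weight_cong: "(\<And>e. e \<in> S \<Longrightarrow> \<omega> e = \<omega>' e) \<Longrightarrow> weight \<omega> S = weight \<omega>' S"
  by (simp add: weight_def cong: sum.cong)

text \<open>Non-uniqueness of the minimum, localised at one element, so that the union bound runs
  over elements of the ground set rather than over pairs of members. Equal weight makes
  \<open>S'\<close> a minimiser along with \<open>S\<close>.\<close>

definition ambiguous :: "'u set set \<Rightarrow> 'u \<Rightarrow> ('u \<Rightarrow> nat) \<Rightarrow> bool" where
  "ambiguous F x \<omega> \<longleftrightarrow> (\<exists>S\<in>F. \<exists>S'\<in>F. x \<in> S \<and> x \<notin> S' \<and>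
     weight \<omega> S = weight \<omega> S' \<and> (\<forall>T\<in>F. weight \<omega> S \<le> weight \<omega> T))"

text \<open>A minimum exists, so isolation can only fail through a second minimiser; any element of
  the symmetric difference of the two serves as \<open>x\<close>.\<close>

lemma not_isolates_imp_ambiguous:
  assumes "finite F" "F \<noteq> {}" "\<not> isolates \<omega> F"
  obtains x where "x \<in> \<Union>F" "ambiguous F x \<omega>"
proof -
  define k where "k = Min (weight \<omega> ` F)"
  have fin: "finite (weight \<omega> ` F)" "weight \<omega> ` F \<noteq> {}" using assms by auto
  have "k \<in> weight \<omega> ` F" unfolding k_def using fin by (rule Min_in)
  then obtain S where S: "S \<in> F" "weight \<omega> S = k" by auto
  have min: "k \<le> weight \<omega> T" if "T \<in> F" for T
    unfolding k_def using fin that by (intro Min_le) auto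
  obtain S' where S': "S' \<in> F" "weight \<omega> S' = k" "S' \<noteq> S"
    using assms(3) S unfolding isolates_def k_def[symmetric] by blast
  then consider x where "x \<in> S" "x \<notin> S'" | x where "x \<in> S'" "x \<notin> S" by blast
  then show thesis
  proof cases
    case 1
    have "ambiguous F x \<omega>"
      unfolding ambiguous_def by (intro bexI[of _ S] bexI[of _ S']) (use 1 S S' min in auto)
    with 1 S show thesis by (blast intro: that)
  next
    case 2
    have "ambiguous F x \<omega>"
      unfolding ambiguous_def by (intro bexI[of _ S'] bexI[of _ S]) (use 2 S S' min in auto)
    with 2 S' show thesis by (blast intro: that)
  qed
qed

text \<open>Compare a minimiser \<open>S\<close> for \<omega> containing \<open>x\<close> with the
  minimisers \<open>T\<close>, \<open>T'\<close> for \<omega>', where \<open>T'\<close> avoids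
  \<open>x\<close> and so weighs the same under both functions: \<omega>(S) \<le> \<omega>(T') =
  \<omega>'(T') = \<omega>'(T) \<le> \<omega>'(S). The weights of \<open>S\<close> differ only by
  the contribution of \<open>x\<close>.\<close>

lemma ambiguous_le:
  assumes "ambiguous F x \<omega>" "ambiguous F x \<omega>'" "\<And>S. S \<in> F \<Longrightarrow> finite S"
    and eq: "\<And>e. e \<noteq> x \<Longrightarrow> \<omega> e = \<omega>' e"
  shows "\<omega> x \<le> \<omega>' x"
proof -
  obtain S S' where S: "S \<in> F" "S' \<in> F" "x \<in> S" "x \<notin> S'" "weight \<omega> S = weight \<omega> S'"
    "\<And>T. T \<in> F \<Longrightarrow> weight \<omega> S \<le> weight \<omega> T"
    using assms(1) unfolding ambiguous_def by blast
  obtain T T' where T: "T \<in> F" "T' \<in> F" "x \<in> T" "x \<notin> T'" "weight \<omega>' T = weight \<omega>' T'"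
    "\<And>U. U \<in> F \<Longrightarrow> weight \<omega>' T \<le> weight \<omega>' U"
    using assms(2) unfolding ambiguous_def by blast
  have "weight \<omega> T' = weight \<omega>' T'"
    using T(4) by (intro weight_cong eq) auto
  moreover have "weight \<omega> (S - {x}) = weight \<omega>' (S - {x})"
    by (intro weight_cong eq) auto
  moreover have "weight \<omega> S = \<omega> x + weight \<omega> (S - {x})"
      "weight \<omega>' S = \<omega>' x + weight \<omega>' (S - {x})"
    using S(1,3) assms(3) by (simp_all only: weight_remove[of S x])
  moreover have "weight \<omega> S \<le> weight \<omega> T'" "weight \<omega>' T \<le> weight \<omega>' S" using S T by auto
  ultimately show ?thesis using T(5) by linarith
qed

text \<open>The weight of an ambiguous element is determined by the weights of the other elements.\<close>

lemma card_ambiguous_le: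
  assumes "finite U" "x \<in> U" "\<And>S. S \<in> F \<Longrightarrow> finite S"
  shows "card {\<omega> \<in> U \<rightarrow>\<^sub>E {1..K}. ambiguous F x \<omega>} \<le> K ^ (card U - 1)"
proof -
  let ?A = "{\<omega> \<in> U \<rightarrow>\<^sub>E {1..K}. ambiguous F x \<omega>}"
  have "inj_on (\<lambda>\<omega>. restrict \<omega> (U - {x})) ?A"
  proof (rule inj_onI)
    fix \<omega> \<omega>' assume A: "\<omega> \<in> ?A" "\<omega>' \<in> ?A"
      and R: "restrict \<omega> (U - {x}) = restrict \<omega>' (U - {x})"
    have eq: "\<omega> e = \<omega>' e" if "e \<noteq> x" for e
    proof (cases "e \<in> U")
      case True
      then show ?thesis using fun_cong[OF R, of e] that by simp
    next
      case False
      \<comment> \<open>Members of \<open>PiE\<close> are extensional, so the two functions also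
        agree outside \<open>U\<close>.\<close>
      with A have "\<omega> e = undefined" "\<omega>' e = undefined"
        by (blast intro: PiE_arb)+
      then show ?thesis by simp
    qed
    have amb: "ambiguous F x \<omega>" "ambiguous F x \<omega>'" using A by auto
    have "\<omega> x \<le> \<omega>' x"
      using amb assms(3) eq by (rule ambiguous_le)
    moreover have "\<omega>' x \<le> \<omega> x"
      using amb(2,1) assms(3) eq[symmetric] by (rule ambiguous_le)
    ultimately have "\<omega> x = \<omega>' x" by simp
    with eq show "\<omega> = \<omega>'" by (metis ext)
  qed
  moreover have "(\<lambda>\<omega>. restrict \<omega> (U - {x})) ` ?A \<subseteq> (U - {x}) \<rightarrow>\<^sub>E {1..K}"
    by (auto simp del: atLeastAtMost_iff restrict_apply intro!: restrict_PiE_iff[THEN iffD2] dest: PiE_mem)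
  moreover have "finite ((U - {x}) \<rightarrow>\<^sub>E {1..K})" using assms(1) by (intro finite_PiE) auto
  ultimately have "card ?A \<le> card ((U - {x}) \<rightarrow>\<^sub>E {1..K})" by (rule card_inj_on_le)
  then show ?thesis using assms by (simp add: card_PiE)
qed

text \<open>Union bound over the possible ambiguous elements. Among the \<open>K ^ card U\<close>
  weight functions this is a failure rate of at most \<open>card U / K\<close>.\<close>

lemma isolation_lemma:
  assumes "finite U" "F \<noteq> {}" "F \<subseteq> Pow U"
  shows "card {\<omega> \<in> U \<rightarrow>\<^sub>E {1..K}. \<not> isolates \<omega> F} \<le> card U * K ^ (card U - 1)"
proof -
  have fin: "finite F" "\<And>S. S \<in> F \<Longrightarrow> finite S"
    using assms(1,3) by (auto intro: finite_subset[of F "Pow U"] finite_subset[of _ U])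
  have "{\<omega> \<in> U \<rightarrow>\<^sub>E {1..K}. \<not> isolates \<omega> F} \<subseteq>
      (\<Union>x\<in>U. {\<omega> \<in> U \<rightarrow>\<^sub>E {1..K}. ambiguous F x \<omega>})"
    using assms(3) by (auto elim!: not_isolates_imp_ambiguous[OF fin(1) assms(2)])
  then have "card {\<omega> \<in> U \<rightarrow>\<^sub>E {1..K}. \<not> isolates \<omega> F} \<le>
      card (\<Union>x\<in>U. {\<omega> \<in> U \<rightarrow>\<^sub>E {1..K}. ambiguous F x \<omega>})"
    using assms(1) by (intro card_mono) (auto intro!: finite_PiE)
  also have "\<dots> \<le> (\<Sum>x\<in>U. card {\<omega> \<in> U \<rightarrow>\<^sub>E {1..K}. ambiguous F x \<omega>})"
    using assms(1) by (rule card_UN_le)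
  also have "\<dots> \<le> (\<Sum>x\<in>U. K ^ (card U - 1))"
    using assms(1) fin by (intro sum_mono card_ambiguous_le) auto
  finally show ?thesis by simp
qed

section \<open>Amplification by conditional expectations\<close>

text \<open>Double counting: averaged over \<open>W\<close>, the \<open>w\<close>-mass of the
  families on which \<omega> is bad is at most a \<open>1/c\<close> fraction of the total, and some
  \<omega> does no worse than the average.\<close>

lemma exists_below_average:
  fixes w :: "'f \<Rightarrow> nat"
  assumes "finite W" "W \<noteq> {}" "finite \<F>"
    and rare: "\<And>F. F \<in> \<F> \<Longrightarrow> c * card {\<omega> \<in> W. bad \<omega> F} \<le> card W"
  obtains \<omega> where "\<omega> \<in> W" "c * (\<Sum>F | F \<in> \<F> \<and> bad \<omega> F. w F) \<le> (\<Sum>F\<in>\<F>. w F)"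
proof -
  have "(\<Sum>\<omega>\<in>W. c * (\<Sum>F | F \<in> \<F> \<and> bad \<omega> F. w F)) =
      c * (\<Sum>F\<in>\<F>. \<Sum>\<omega> | \<omega> \<in> W \<and> bad \<omega> F. w F)"
    unfolding sum_distrib_left[symmetric] using assms(1,3) by (subst sum.swap_restrict) auto
  also have "\<dots> = (\<Sum>F\<in>\<F>. c * card {\<omega> \<in> W. bad \<omega> F} * w F)"
    by (simp add: sum_distrib_left mult.assoc)
  also have "\<dots> \<le> (\<Sum>F\<in>\<F>. card W * w F)"
    using rare by (intro sum_mono mult_right_mono) auto
  also have "\<dots> = (\<Sum>\<omega>\<in>W. \<Sum>F\<in>\<F>. w F)" by (simp add: sum_distrib_left)
  finally have le: "(\<Sum>\<omega>\<in>W. c * (\<Sum>F | F \<in> \<F> \<and> bad \<omega> F. w F)) \<le> (\<Sum>\<omega>\<in>W. \<Sum>F\<in>\<F>. w F)" .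
  \<comment> \<open>Keeps the goal's elimination rule accessible, since the \<open>if\<close> below
    rebinds \<open>that\<close>.\<close>
  note * = that
  show thesis
  proof (rule ccontr)
    assume "\<not> thesis"
    then have "(\<Sum>F\<in>\<F>. w F) < c * (\<Sum>F | F \<in> \<F> \<and> bad \<omega> F. w F)" if "\<omega> \<in> W" for \<omega>
      using *[OF that] by (meson not_le)
    then show False using sum_strict_mono[OF assms(1,2)] le by (meson not_le)
  qed
qed

text \<open>Adding a weight function multiplies by 16 only the terms on which it is bad. A choice
  below average makes these carry at most 1/16 of the potential, so the increase is at most the old
  potential.\<close>

lemma exists_sequence_potential_le:
  assumes "finite W" "W \<noteq> {}" "finite \<F>"
    and rare: "\<And>F. F \<in> \<F> \<Longrightarrow> 16 * card {\<omega> \<in> W. bad \<omega> F} \<le> card W"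
  shows "\<exists>\<omega>. (\<forall>i\<in>{1..l::nat}. \<omega> i \<in> W) \<and>
    (\<Sum>F\<in>\<F>. 16 ^ card {i \<in> {1..l}. bad (\<omega> i) F}) \<le> 2 ^ l * card \<F>"
proof (induction l)
  case 0
  then show ?case by simp
next
  case (Suc l)
  then obtain \<omega> where \<omega>: "\<And>i. i \<in> {1..l} \<Longrightarrow> \<omega> i \<in> W"
    and IH: "(\<Sum>F\<in>\<F>. 16 ^ card {i \<in> {1..l}. bad (\<omega> i) F}) \<le> 2 ^ l * card \<F>" by blast
  define w :: "'b \<Rightarrow> nat" where "w F = 16 ^ card {i \<in> {1..l}. bad (\<omega> i) F}" for F
  obtain \<eta> where \<eta>: "\<eta> \<in> W" "16 * (\<Sum>F | F \<in> \<F> \<and> bad \<eta> F. w F) \<le> (\<Sum>F\<in>\<F>. w F)"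
    using exists_below_average[OF assms(1-3), where c = 16 and bad = bad and w = w] rare by blast
  define \<omega>' where "\<omega>' = \<omega>(Suc l := \<eta>)"
  \<comment> \<open>The new term is \<open>w F\<close> or \<open>16 * w F\<close>; bounding the
    latter by \<open>17 * w F\<close> gives a form that splits under summation.\<close>
  have step: "16 ^ card {i \<in> {1..Suc l}. bad (\<omega>' i) F} \<le> w F + 16 * (if bad \<eta> F then w F else 0)"
    for F
  proof -
    have "{i \<in> {1..Suc l}. bad (\<omega>' i) F} =
        (if bad \<eta> F then {Suc l} else {}) \<union> {i \<in> {1..l}. bad (\<omega> i) F}"
      by (auto simp: \<omega>'_def atLeastAtMostSuc_conv)
    then show ?thesis by (simp add: w_def)
  qed
  have "(\<Sum>F\<in>\<F>. 16 ^ card {i \<in> {1..Suc l}. bad (\<omega>' i) F}) \<le>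
      (\<Sum>F\<in>\<F>. w F + 16 * (if bad \<eta> F then w F else 0))"
    using step by (rule sum_mono)
  also have "\<dots> = (\<Sum>F\<in>\<F>. w F) + 16 * (\<Sum>F | F \<in> \<F> \<and> bad \<eta> F. w F)"
    using assms(3) by (simp add: sum.distrib sum.inter_filter sum_distrib_left[symmetric])
  also have "\<dots> \<le> 2 * (\<Sum>F\<in>\<F>. w F)" using \<eta>(2) by simp
  also have "\<dots> \<le> 2 ^ Suc l * card \<F>" using IH by (simp add: w_def)
  finally have "(\<Sum>F\<in>\<F>. 16 ^ card {i \<in> {1..Suc l}. bad (\<omega>' i) F}) \<le> 2 ^ Suc l * card \<F>" .
  moreover have "\<forall>i\<in>{1..Suc l}. \<omega>' i \<in> W" using \<omega> \<eta>(1) by (auto simp: \<omega>'_def)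
  ultimately show ?case by blast
qed

text \<open>A single term is at most the whole potential, which is at most \<open>4 ^ l\<close>.
  Since 16 is the square of 4, no family can meet more than \<open>l / 2\<close> failures.\<close>

lemma exists_sequence_mostly_good:
  assumes "finite W" "W \<noteq> {}" "finite \<F>" "card \<F> \<le> 2 ^ l"
    and rare: "\<And>F. F \<in> \<F> \<Longrightarrow> 16 * card {\<omega> \<in> W. bad \<omega> F} \<le> card W"
  obtains \<omega> where "\<And>i. i \<in> {1..l} \<Longrightarrow> \<omega> i \<in> W"
    "\<And>F. F \<in> \<F> \<Longrightarrow> l \<le> 2 * card {i \<in> {1..l}. \<not> bad (\<omega> i) F}"
proof -
  obtain \<omega> where \<omega>: "\<And>i. i \<in> {1..l} \<Longrightarrow> \<omega> i \<in> W"
    and le: "(\<Sum>F\<in>\<F>. 16 ^ card {i \<in> {1..l}. bad (\<omega> i) F}) \<le> 2 ^ l * card \<F>"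
    using exists_sequence_potential_le[OF assms(1-3), of bad l] rare by blast
  have "l \<le> 2 * card {i \<in> {1..l}. \<not> bad (\<omega> i) F}" if F: "F \<in> \<F>" for F
  proof -
    let ?B = "{i \<in> {1..l}. bad (\<omega> i) F}"
    have "(2::nat) ^ (4 * card ?B) = 16 ^ card ?B" by (simp add: power_mult)
    also have "\<dots> \<le> (\<Sum>F\<in>\<F>. 16 ^ card {i \<in> {1..l}. bad (\<omega> i) F})"
      using assms(3) F by (intro member_le_sum) auto
    also have "\<dots> \<le> 2 ^ l * card \<F>" by (rule le)
    also have "\<dots> \<le> 2 ^ l * 2 ^ l" using assms(4) by simp
    finally have "(2::nat) ^ (4 * card ?B) \<le> 2 ^ (2 * l)" by (simp add: mult_2 power_add)
    then have "4 * card ?B \<le> 2 * l" by simp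
    moreover have "{1..l} - ?B = {i \<in> {1..l}. \<not> bad (\<omega> i) F}" by auto
    then have "card {i \<in> {1..l}. \<not> bad (\<omega> i) F} = l - card ?B"
      using card_Diff_subset[of ?B "{1..l}"] by fastforce
    ultimately show ?thesis by linarith
  qed
  with \<omega> show thesis by (rule that)
qed

section \<open>Hamiltonian cycles up to renaming of vertices\<close>

lemma cycle_edges_map: "cycle_edges (map g vs) = (`) g ` cycle_edges vs"
proof -
  have "cycle_edges (map g vs) = (\<lambda>i. {map g vs ! i, map g vs ! (Suc i mod length vs)}) ` {..<length vs}"
    unfolding cycle_edges_def length_map by blast
  also have "\<dots> = (\<lambda>i. g ` {vs ! i, vs ! (Suc i mod length vs)}) ` {..<length vs}"
  proof (rule image_cong)
    fix i assume "i \<in> {..<length vs}"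
    then have "i < length vs" "Suc i mod length vs < length vs" by (auto intro: mod_less_divisor)
    then show "{map g vs ! i, map g vs ! (Suc i mod length vs)} =
        g ` {vs ! i, vs ! (Suc i mod length vs)}" by simp
  qed simp
  also have "\<dots> = (`) g ` cycle_edges vs" unfolding cycle_edges_def by blast
  finally show ?thesis .
qed

lemma HC_image:
  assumes "inj_on g V" "H \<in> HC V E"
  shows "(`) g ` H \<in> HC (g ` V) ((`) g ` E)"
proof -
  obtain vs where vs: "H = cycle_edges vs" "hamiltonian_cycle V E vs"
    using assms(2) by (auto simp: HC_def)
  then have "hamiltonian_cycle (g ` V) ((`) g ` E) (map g vs)"
    using assms(1) by (auto simp: hamiltonian_cycle_def distinct_map cycle_edges_map)
  then show ?thesis
    unfolding vs(1) HC_def cycle_edges_map[symmetric] by blast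
qed

text \<open>The family lives on edge indices, so vertex names leave no trace in it. The converse
  inclusion applies \<open>HC_image\<close> to the inverse of \<open>g\<close>, which undoes
  \<open>g\<close> on every edge because edges lie inside \<open>V\<close>.\<close>

lemma HC_enum_rename:
  assumes "inj_on g V" "E \<subseteq> Pow V" "f ` {1..m} \<subseteq> E"
  shows "HC_enum V E m f = HC_enum (g ` V) ((`) g ` E) m (\<lambda>i. g ` f i)"
proof -
  define h where "h = inv_into V g"
  have inv: "h ` g ` A = A" if "A \<subseteq> V" for A
    unfolding h_def using assms(1) that by (rule inv_into_image_cancel)
  have inv2: "(`) h ` (`) g ` \<A> = \<A>" if "\<A> \<subseteq> E" for \<A>
  proof -
    have "(`) h ` (`) g ` \<A> = (\<lambda>A. A) ` \<A>"
      unfolding image_image using inv that assms(2)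
      by (intro image_cong) (auto simp: image_image[symmetric] simp del: image_ident)
    then show ?thesis by simp
  qed
  have "f ` X \<in> HC V E \<longleftrightarrow> (\<lambda>i. g ` f i) ` X \<in> HC (g ` V) ((`) g ` E)" if X: "X \<subseteq> {1..m}" for X
  proof
    assume "f ` X \<in> HC V E"
    then show "(\<lambda>i. g ` f i) ` X \<in> HC (g ` V) ((`) g ` E)"
      using HC_image[OF assms(1)] by (force simp: image_image)
  next
    assume "(\<lambda>i. g ` f i) ` X \<in> HC (g ` V) ((`) g ` E)"
    then have "(`) g ` f ` X \<in> HC (g ` V) ((`) g ` E)" by (simp add: image_image)
    moreover have "inj_on h (g ` V)" unfolding h_def by (rule inj_on_inv_into) simp
    ultimately have "(`) h ` (`) g ` f ` X \<in> HC (h ` g ` V) ((`) h ` (`) g ` E)"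
      by (rule HC_image[rotated])
    moreover have "f ` X \<subseteq> E" using X assms(3) by blast
    ultimately show "f ` X \<in> HC V E" using inv[of V] inv2 by simp
  qed
  then show ?thesis unfolding HC_enum_def by auto
qed

lemma HC_enum_cong:
  assumes "\<And>i. i \<in> {1..m} \<Longrightarrow> f i = f' i"
  shows "HC_enum V E m f = HC_enum V E m f'"
proof -
  have "f ` X = f' ` X" if "X \<subseteq> {1..m}" for X
    using assms that by (intro image_cong) auto
  then show ?thesis unfolding HC_enum_def by auto
qed

lemma HC_enum_nonempty:
  assumes "bij_betw f {1..m} E" "HC V E \<noteq> {}"
  shows "HC_enum V E m f \<noteq> {}"
proof -
  obtain H where H: "H \<in> HC V E" "H \<subseteq> E"
    using assms(2) by (auto simp: HC_def hamiltonian_cycle_def)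
  then obtain X where "X \<subseteq> {1..m}" "H = f ` X"
    using assms(1) by (metis bij_betw_imp_surj_on subset_imageE)
  with H show ?thesis by (auto simp: HC_enum_def)
qed

definition HC_families :: "nat \<Rightarrow> nat \<Rightarrow> nat set set set" where
  "HC_families n m = (\<lambda>f. HC_enum {..<n} (f ` {1..m}) m f) ` ({1..m} \<rightarrow>\<^sub>E Pow {..<n})"

lemma finite_HC_families: "finite (HC_families n m)"
  unfolding HC_families_def by (intro finite_imageI finite_PiE) auto

lemma card_HC_families_le: "card (HC_families n m) \<le> 2 ^ (n * m)"
proof -
  have "card (HC_families n m) \<le> card ({1..m} \<rightarrow>\<^sub>E Pow {..<n})"
    unfolding HC_families_def by (intro card_image_le finite_PiE) auto
  also have "\<dots> = 2 ^ (n * m)" by (simp add: card_PiE card_Pow power_mult)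
  finally show ?thesis .
qed

lemma HC_enum_in_HC_families:
  assumes "simple_graph V E" "card V = n" "bij_betw f {1..m} E"
  shows "HC_enum V E m f \<in> HC_families n m"
proof -
  have V: "finite V" "E \<subseteq> Pow V" using assms(1) by (auto simp: simple_graph_def)
  have f: "f ` {1..m} = E" using assms(3) by (rule bij_betw_imp_surj_on)
  obtain g where "bij_betw g V {..<n}"
    using V(1) assms(2) by (metis bij_betw_iff_card card_lessThan finite_lessThan)
  then have g: "inj_on g V" "g ` V = {..<n}" by (auto simp: bij_betw_def)
  \<comment> \<open>The restriction makes the renamed enumeration extensional, as membership in
    \<open>PiE\<close> demands.\<close>
  define f' where "f' = restrict (\<lambda>i. g ` f i) {1..m}"
  have "f i \<subseteq> V" if "i \<in> {1..m}" for i using f V that by blast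
  then have "f' \<in> {1..m} \<rightarrow>\<^sub>E Pow {..<n}"
    unfolding f'_def g(2)[symmetric] by (auto simp: image_mono)
  moreover have "f' ` {1..m} = (`) g ` E" unfolding f'_def f[symmetric] by (simp add: image_image)
  moreover have "HC_enum V E m f = HC_enum (g ` V) ((`) g ` E) m (\<lambda>i. g ` f i)"
    using g V f by (intro HC_enum_rename) auto
  moreover have "\<dots> = HC_enum {..<n} ((`) g ` E) m f'"
    unfolding g(2) by (rule HC_enum_cong) (simp add: f'_def)
  ultimately show ?thesis unfolding HC_families_def by (intro image_eqI[of _ _ f']) auto
qed

section \<open>The isolation scheme\<close>

text \<open>Weights up to \<open>16 * m\<close> bring the failure rate \<open>m / (16 * m)\<close>
  down to 1/16, and the length \<open>n * m\<close> matches the bound \<open>2 ^ (n * m)\<close> on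
  the number of families.\<close>

lemma isolation_scheme_HC_enum:
  assumes "0 < m"
  obtains \<omega> where "\<And>i e. i \<in> {1..n * m} \<Longrightarrow> e \<in> {1..m} \<Longrightarrow> \<omega> i e \<le> 16 * m"
    "\<And>V E f. simple_graph V E \<Longrightarrow> card V = n \<Longrightarrow> bij_betw f {1..m} E \<Longrightarrow> HC V E \<noteq> {} \<Longrightarrow>
       n * m \<le> 2 * card {i \<in> {1..n * m}. isolates (\<omega> i) (HC_enum V E m f)}"
proof -
  define W where "W = {1..m} \<rightarrow>\<^sub>E {1..16 * m}"
  have W: "finite W" "W \<noteq> {}" "card W = (16 * m) ^ m"
    using assms unfolding W_def by (auto simp: card_PiE PiE_eq_empty_iff intro!: finite_PiE)
  \<comment> \<open>The empty family is removed because no weight function isolates it.\<close>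
  have fin: "finite (HC_families n m - {{}})" using finite_HC_families by simp
  have "card (HC_families n m - {{}}) \<le> card (HC_families n m)"
    using finite_HC_families by (intro card_mono) auto
  then have card: "card (HC_families n m - {{}}) \<le> 2 ^ (n * m)"
    using card_HC_families_le le_trans by blast
  have rare: "16 * card {\<omega> \<in> W. \<not> isolates \<omega> F} \<le> card W" if "F \<in> HC_families n m - {{}}" for F
  proof -
    have "F \<noteq> {}" "F \<subseteq> Pow {1..m}" using that by (auto simp: HC_families_def HC_enum_def)
    then have "16 * card {\<omega> \<in> W. \<not> isolates \<omega> F} \<le> 16 * (m * (16 * m) ^ (m - 1))"
      using isolation_lemma[of "{1..m}" F "16 * m"] unfolding W_def by simp
    also have "\<dots> = (16 * m) ^ m" using assms by (cases m) (auto simp: algebra_simps)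
    finally show ?thesis using W by simp
  qed
  obtain \<omega> where \<omega>: "\<And>i. i \<in> {1..n * m} \<Longrightarrow> \<omega> i \<in> W"
    \<comment> \<open>The double negation arises from instantiating \<open>bad\<close> with failure
      to isolate.\<close>
    "\<And>F. F \<in> HC_families n m - {{}} \<Longrightarrow> n * m \<le> 2 * card {i \<in> {1..n * m}. \<not> \<not> isolates (\<omega> i) F}"
    using exists_sequence_mostly_good[OF W(1,2) fin card, of "\<lambda>\<omega> F. \<not> isolates \<omega> F"] rare
    by blast
  show thesis
  proof (rule that)
    fix i e assume "i \<in> {1..n * m}" "e \<in> {1..m}"
    then have "\<omega> i e \<in> {1..16 * m}" using \<omega>(1) unfolding W_def by (blast dest: PiE_mem)
    then show "\<omega> i e \<le> 16 * m" by simp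
  next
    fix V :: "'a set" and E f
    assume "simple_graph V E" "card V = n" "bij_betw f {1..m} E" "HC V E \<noteq> {}"
    then have "HC_enum V E m f \<in> HC_families n m - {{}}"
      using HC_enum_in_HC_families HC_enum_nonempty by blast
    from \<omega>(2)[OF this] show
      "n * m \<le> 2 * card {i \<in> {1..n * m}. isolates (\<omega> i) (HC_enum V E m f)}" by simp
  qed
qed

theorem theorem1p1:
  "\<exists>C::real. \<forall>n m :: nat. \<exists>(l::nat) (\<omega> :: nat \<Rightarrow> nat \<Rightarrow> nat).
     l \<ge> 1 \<and> log 2 (real l) \<le> C * real n \<and>
     (\<forall>i\<in>{1..l}. \<forall>e\<in>{1..m}. real (\<omega> i e) \<le> 2 powr (C * real n)) \<and>
     (\<forall>(V :: nat set) (E :: nat set set) (f :: nat \<Rightarrow> nat set).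
        simple_graph V E \<and> card V = n \<and> bij_betw f {1..m} E \<and> HC V E \<noteq> {} \<longrightarrow>
        real (card {i\<in>{1..l}. isolates (\<omega> i) (HC_enum V E m f)}) \<ge> real l / 2)"
\<comment> \<open>The constant 5 comes from 16 * m \<le> 2 ^ (4 + n) \<le> 2 ^ (5 * n), where
  \<open>n\<close> is positive.\<close>
proof (intro exI[of _ "5::real"] allI)
  fix n m :: nat
  show "\<exists>(l::nat) (\<omega> :: nat \<Rightarrow> nat \<Rightarrow> nat).
     l \<ge> 1 \<and> log 2 (real l) \<le> 5 * real n \<and>
     (\<forall>i\<in>{1..l}. \<forall>e\<in>{1..m}. real (\<omega> i e) \<le> 2 powr (5 * real n)) \<and>
     (\<forall>(V :: nat set) (E :: nat set set) (f :: nat \<Rightarrow> nat set).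
        simple_graph V E \<and> card V = n \<and> bij_betw f {1..m} E \<and> HC V E \<noteq> {} \<longrightarrow>
        real (card {i\<in>{1..l}. isolates (\<omega> i) (HC_enum V E m f)}) \<ge> real l / 2)"
  \<comment> \<open>If no Hamiltonian graph has these parameters, a single zero weight function
    satisfies the claim vacuously. Otherwise one such graph supplies the bounds relating
    \<open>m\<close> to \<open>n\<close>.\<close>
  proof (cases "\<exists>(V :: nat set) E f. simple_graph V E \<and> card V = n \<and> bij_betw f {1..m} E \<and> HC V E \<noteq> {}")
    case False
    then show ?thesis
      by (intro exI[of _ 1] exI[of _ "\<lambda>_ _. 0"]) auto
  next
    case True
    then obtain V :: "nat set" and E f where G: "simple_graph V E" "card V = n" "bij_betw f {1..m} E"
      and HC: "HC V E \<noteq> {}" by blast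
    have V: "finite V" "E \<subseteq> Pow V" using G(1) by (auto simp: simple_graph_def)
    obtain vs where vs: "3 \<le> length vs" "set vs = V" "cycle_edges vs \<subseteq> E"
      using HC by (auto simp: HC_def hamiltonian_cycle_def)
    then have "V \<noteq> {}" by auto
    with V(1) G(2) have n: "0 < n" by auto
    have "card E = m" using G(3) bij_betw_same_card by fastforce
    \<comment> \<open>Edges are merely counted as subsets of \<open>V\<close>; this crude
      exponential bound suffices, since both target bounds are exponential in
      \<open>n\<close>.\<close>
    then have m: "m \<le> 2 ^ n" using V G(2) by (metis card_Pow card_mono finite_Pow_iff)
    have "cycle_edges vs \<noteq> {}" using vs(1) by (auto simp: cycle_edges_def intro: exI[of _ 0])
    with vs(3) have "E \<noteq> {}" by blast
    then have "0 < m" using G(3) by (cases m) (auto simp: bij_betw_def)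
    have nm: "real (n * m) \<le> 2 ^ (5 * n)"
    proof -
      have "n * m \<le> 2 ^ n * 2 ^ n" using m by (intro mult_mono) auto
      also have "\<dots> = 2 ^ (2 * n)" by (simp add: mult_2 power_add)
      also have "\<dots> \<le> 2 ^ (5 * n)" by (intro power_increasing) auto
      finally have "real (n * m) \<le> real (2 ^ (5 * n))" by (simp only: of_nat_le_iff)
      then show ?thesis by simp
    qed
    have m16: "real (16 * m) \<le> 2 ^ (5 * n)"
    proof -
      have "16 * m \<le> 2 ^ 4 * 2 ^ n" using m by simp
      also have "\<dots> = 2 ^ (4 + n)" by (simp only: power_add)
      also have "\<dots> \<le> 2 ^ (5 * n)" using n by (intro power_increasing) auto
      finally have "real (16 * m) \<le> real (2 ^ (5 * n))" by (simp only: of_nat_le_iff)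
      then show ?thesis by simp
    qed
    have pow: "(2::real) powr (5 * real n) = 2 ^ (5 * n)"
      using powr_realpow[of "2::real" "5 * n"] by simp
    obtain \<omega> where \<omega>: "\<And>i e. i \<in> {1..n * m} \<Longrightarrow> e \<in> {1..m} \<Longrightarrow> \<omega> i e \<le> 16 * m"
      "\<And>(V :: nat set) E f. simple_graph V E \<Longrightarrow> card V = n \<Longrightarrow> bij_betw f {1..m} E \<Longrightarrow>
         HC V E \<noteq> {} \<Longrightarrow>
         n * m \<le> 2 * card {i \<in> {1..n * m}. isolates (\<omega> i) (HC_enum V E m f)}"
      using isolation_scheme_HC_enum[OF \<open>0 < m\<close>] by blast
    have "1 \<le> n * m" using n \<open>0 < m\<close> by (simp add: Suc_le_eq)
    moreover have "log 2 (real (n * m)) \<le> 5 * real n"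
      using \<open>1 \<le> n * m\<close> nm pow by (subst log_le_iff) auto
    moreover have "real (\<omega> i e) \<le> 2 powr (5 * real n)" if "i \<in> {1..n * m}" "e \<in> {1..m}" for i e
      using \<omega>(1)[OF that] m16 unfolding pow by linarith
    moreover have "real (card {i\<in>{1..n * m}. isolates (\<omega> i) (HC_enum V E m f)}) \<ge> real (n * m) / 2"
      if "simple_graph V E" "card V = n" "bij_betw f {1..m} E" "HC V E \<noteq> {}"
      for V :: "nat set" and E f
      using \<omega>(2)[OF that] by linarith
    ultimately show ?thesis by (intro exI[of _ "n * m"] exI[of _ \<omega>]) blast
  qed
qed

end
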